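(* Let $\mathcal{R}$ be a $\ast$-ring and let $a\in\mathcal{R}$. Then the following are equivalent: (i) $a$ is right core invertible; (ii) $a\in\mathcal{R}^{\{1,3\}}$ and $a\mathcal{R}=a^{2}\mathcal{R}$; (iii) $a\in\mathcal{R}^{\{1,3\}}$ and $a\mathcal{R}=a^{n}\mathcal{R}$ for every integer $n\geq 2$; (iv) $a\in\mathcal{R}^{\{1,3\}}$ and $a\mathcal{R}=a^{n}\mathcal{R}$ for some integer $n\geq 2$; (v) for every integer $n\geq 2$, $a^{n}$ is right core invertible and $a\mathcal{R}=a^{n}\mathcal{R}$; (vi) for some integer $n\geq 2$, $a^{n}$ is right core invertible and $a\mathcal{R}=a^{n}\mathcal{R}$; (vii) for all integers $n\geq 2$ and $k>n$, $a^n\in\mathcal{R}^{\{1,3\}}$ and $a\mathcal{R}=a^{k}\mathcal{R}$; (viii) for some integers $n\geq 2$ and $k>n$, $a^n\in\mathcal{R}^{\{1,3\}}$ and $a\mathcal{R}=a^{k}\mathcal{R}$. In this case, for every $n\geq 2$: if $x$ is a right core inverse of $a$, then $x^n$ is a right core inverse of $a^n$; and if $y$ is a right core inverse of $a^n$, then $a^{n-1}y$ is a right core inverse of $a$.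
   Context: A $\ast$-ring is an associative ring $\mathcal{R}$ with identity $1$ equipped with an involution, i.e. a map $\ast:\mathcal{R}\to\mathcal{R}$ with $(a^\ast)^\ast=a$, $(a+b)^\ast=a^\ast+b^\ast$, $(ab)^\ast=b^\ast a^\ast$ for all $a,b\in\mathcal{R}$. $\mathcal{R}^{\{1,3\}}$ is the set of $a\in\mathcal{R}$ for which there is $x\in\mathcal{R}$ with $axa=a$ and $(ax)^\ast=ax$. An element $a\in\mathcal{R}$ is right core invertible if $a^\ast\in a^\ast a^2\mathcal{R}$, equivalently if there exists $x\in a\mathcal{R}$ with $a^\ast a x=a^\ast$; any such $x$ is called a right core inverse of $a$ (not necessarily unique). *)

theory Defs
  imports Main
begin

text \<open>
  The sort combines \<open>ring\<close> with \<open>monoid_mult\<close> instead of using \<open>ring_1\<close>, because the latter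
  demands \<open>0 \<noteq> 1\<close> and would exclude the zero ring.
\<close>
class star_ring = ring + monoid_mult +
  fixes star :: "'a \<Rightarrow> 'a"  ("_\<^sup>\<star>" [1000] 999)
  assumes star_star: "(a\<^sup>\<star>)\<^sup>\<star> = a"
    and star_add: "(a + b)\<^sup>\<star> = a\<^sup>\<star> + b\<^sup>\<star>"
    and star_mult: "(a * b)\<^sup>\<star> = b\<^sup>\<star> * a\<^sup>\<star>"

definition right_ideal :: "'a::star_ring \<Rightarrow> 'a set" where
  "right_ideal a = {a * r | r. True}"

definition inv13 :: "'a::star_ring set" where
  "inv13 = {a. \<exists>x. a * x * a = a \<and> (a * x)\<^sup>\<star> = a * x}"

definition right_core_invertible :: "'a::star_ring \<Rightarrow> bool" where
  "right_core_invertible a \<longleftrightarrow> a\<^sup>\<star> \<in> right_ideal (a\<^sup>\<star> * a ^ 2)"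

definition right_core_inverse :: "'a::star_ring \<Rightarrow> 'a \<Rightarrow> bool" where
  "right_core_inverse a x \<longleftrightarrow> x \<in> right_ideal a \<and> a\<^sup>\<star> * a * x = a\<^sup>\<star>"

lemma right_core_invertible_iff: "right_core_invertible a \<longleftrightarrow> (\<exists>x. right_core_inverse a x)"
  unfolding right_core_invertible_def right_core_inverse_def right_ideal_def
  by (simp add: power2_eq_square mult.assoc) metis

end

theory Submission
  imports Defs
begin

text \<open>
  A right core inverse of \<open>a\<close> is the same as a \<open>{1,3}\<close>-inverse \<open>x\<close> with \<open>a x\<^sup>2 = x\<close>. For such an \<open>x\<close>
  one has \<open>a\<^sup>n x\<^sup>n = a x\<close> for every \<open>n \<ge> 1\<close>, so \<open>a = a\<^sup>n x\<^sup>n a\<close> and all powers of \<open>a\<close> inherit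
  the property. Conversely, if \<open>a \<in> a\<^sup>n R\<close> and \<open>y\<close> is a \<open>{1,3}\<close>-inverse of \<open>a\<^sup>n\<close>, then the
  projection \<open>a\<^sup>n y\<close> fixes \<open>a\<close>, so that \<open>a\<^sup>n\<^sup>-\<^sup>1 y\<close> is a \<open>{1,3}\<close>-inverse of \<open>a\<close>.
\<close>

text \<open>For a positive exponent, \<open>a ^ n\<close> is a right multiple of \<open>a\<close>,
  so one inclusion is automatic. The other only has to be checked on the generator \<open>a\<close>.
  This turns every ideal equation below into a single factorization.\<close>

lemma right_ideal_eq_power_iff:
  fixes a :: "'a::star_ring"
  assumes "n \<ge> 1"
  shows "right_ideal a = right_ideal (a ^ n) \<longleftrightarrow> (\<exists>t. a = a ^ n * t)"
proof
  assume "right_ideal a = right_ideal (a ^ n)"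
  moreover have "a \<in> right_ideal a"
    unfolding right_ideal_def by (metis (mono_tags, lifting) mem_Collect_eq mult_1_right)
  ultimately show "\<exists>t. a = a ^ n * t"
    by (auto simp: right_ideal_def)
next
  assume "\<exists>t. a = a ^ n * t"
  then obtain t where t: "a = a ^ n * t" ..
  obtain m where n: "n = Suc m"
    using assms by (cases n) auto
  have "a * r = a ^ n * (t * r)" for r
    using t by (metis mult.assoc)
  moreover have "a ^ n * r = a * (a ^ m * r)" for r
    by (simp add: n mult.assoc)
  ultimately show "right_ideal a = right_ideal (a ^ n)"
    unfolding right_ideal_def by blast
qed

text \<open>The right ideals of the powers of \<open>a\<close> form a decreasing chain, so if the
  first and the \<open>k\<close>-th agree, everything between them agrees as well.\<close>

lemma right_ideal_eq_power_mono:
  fixes a :: "'a::star_ring"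
  assumes "right_ideal a = right_ideal (a ^ k)" "1 \<le> m" "m \<le> k"
  shows "right_ideal a = right_ideal (a ^ m)"
proof -
  obtain t where "a = a ^ k * t"
    using assms right_ideal_eq_power_iff[of k a] by auto
  moreover have "a ^ k * t = a ^ m * (a ^ (k - m) * t)"
    using \<open>m \<le> k\<close> by (simp flip: mult.assoc power_add)
  ultimately show ?thesis
    using assms(2) right_ideal_eq_power_iff by metis
qed

lemma right_core_inverse_iff:
  fixes a x :: "'a::star_ring"
  shows "right_core_inverse a x \<longleftrightarrow> a * x * a = a \<and> (a * x)\<^sup>\<star> = a * x \<and> a * x * x = x"
proof
  assume "right_core_inverse a x"
  then obtain r where r: "x = a * r" and x: "a\<^sup>\<star> * a * x = a\<^sup>\<star>"
    by (auto simp: right_core_inverse_def right_ideal_def)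
  have fix_a: "(a * x)\<^sup>\<star> * a = a"
    using arg_cong[OF x, of star] by (simp add: star_mult star_star mult.assoc)
  \<comment> \<open>An element of the form \<open>p\<^sup>\<star> * p\<close> is self-adjoint, so
    this identity makes \<open>a * x\<close> self-adjoint.\<close>
  have "(a * x)\<^sup>\<star> * (a * x) = a * x"
    using fix_a by (metis mult.assoc)
  then have sa: "(a * x)\<^sup>\<star> = a * x"
    by (metis star_mult star_star)
  with fix_a have axa: "a * x * a = a"
    by simp
  \<comment> \<open>Since \<open>a * x\<close> fixes \<open>a\<close> from the left, it fixes every
    element of the right ideal of \<open>a\<close>, in particular \<open>x = a * r\<close>.\<close>
  then have "a * x * x = x"
    using r by (metis mult.assoc)
  with axa sa show "a * x * a = a \<and> (a * x)\<^sup>\<star> = a * x \<and> a * x * x = x"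
    by simp
next
  assume x: "a * x * a = a \<and> (a * x)\<^sup>\<star> = a * x \<and> a * x * x = x"
  then have "x = a * (x * x)"
    by (simp add: mult.assoc)
  moreover have "a\<^sup>\<star> * a * x = a\<^sup>\<star>"
    using x by (metis mult.assoc star_mult)
  ultimately show "right_core_inverse a x"
    by (auto simp: right_core_inverse_def right_ideal_def)
qed

text \<open>The product telescopes from the middle: where the two powers meet, the block
  \<open>a * x * x\<close> collapses to \<open>x\<close>, which lowers both exponents by
  one.\<close>

lemma power_mult_power_eq:
  fixes a x :: "'a::monoid_mult"
  assumes "a * x * x = x"
  shows "a ^ Suc n * x ^ Suc n = a * x"
proof (induction n)
  case (Suc n)
  have "a ^ Suc (Suc n) * x ^ Suc (Suc n) = a ^ Suc n * (a * x * x) * x ^ n"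
    by (simp only: power_Suc2[of a "Suc n"] power_Suc[of x] mult.assoc)
  also have "\<dots> = a ^ Suc n * x ^ Suc n"
    unfolding assms by (simp add: mult.assoc)
  finally show ?case
    using Suc.IH by simp
qed simp

lemma right_core_inverse_power:
  fixes a x :: "'a::star_ring"
  assumes "right_core_inverse a x" "n \<ge> 1"
  shows "right_core_inverse (a ^ n) (x ^ n)" and "a = a ^ n * (x ^ n * a)"
proof -
  obtain m where n: "n = Suc m"
    using assms(2) by (cases n) auto
  from assms(1) have x: "a * x * a = a" "(a * x)\<^sup>\<star> = a * x" "a * x * x = x"
    by (auto simp: right_core_inverse_iff)
  have p: "a ^ n * x ^ n = a * x"
    unfolding n using x(3) by (rule power_mult_power_eq)
  show "a = a ^ n * (x ^ n * a)"
    using p x(1) by (metis mult.assoc)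
  \<comment> \<open>Left multiplication by \<open>a * x\<close> fixes \<open>a\<close> and
    \<open>x\<close>, hence every product starting with one of them. By \<open>p\<close>, this is
    the same as multiplication by \<open>a ^ n * x ^ n\<close>.\<close>
  have "a * x * a ^ n = a ^ n" "a * x * x ^ n = x ^ n"
    unfolding n power_Suc using x by (metis mult.assoc)+
  then show "right_core_inverse (a ^ n) (x ^ n)"
    by (simp add: right_core_inverse_iff p x(2))
qed

lemma inv13_inverse_of_power:
  fixes a y :: "'a::star_ring"
  assumes y: "a ^ n * y * a ^ n = a ^ n" "(a ^ n * y)\<^sup>\<star> = a ^ n * y"
    and n: "n \<ge> 1" and ideal: "right_ideal a = right_ideal (a ^ n)"
  shows "a * (a ^ (n - 1) * y) * a = a"
    and "(a * (a ^ (n - 1) * y))\<^sup>\<star> = a * (a ^ (n - 1) * y)"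
proof -
  have p: "a * (a ^ (n - 1) * y) = a ^ n * y"
    using n by (simp flip: mult.assoc power_Suc)
  obtain t where "a = a ^ n * t"
    using ideal right_ideal_eq_power_iff[OF n] by blast
  then show "a * (a ^ (n - 1) * y) * a = a"
    unfolding p using y(1) by (metis mult.assoc)
  show "(a * (a ^ (n - 1) * y))\<^sup>\<star> = a * (a ^ (n - 1) * y)"
    unfolding p by (rule y(2))
qed

lemma inv13_of_power:
  fixes a :: "'a::star_ring"
  assumes "a ^ n \<in> inv13" "n \<ge> 1" "right_ideal a = right_ideal (a ^ n)"
  shows "a \<in> inv13"
  using assms(1) inv13_inverse_of_power[OF _ _ assms(2,3)] unfolding inv13_def by blast

lemma right_core_inverse_of_power:
  fixes a y :: "'a::star_ring"
  assumes y: "right_core_inverse (a ^ n) y"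
    and n: "n \<ge> 2" and ideal: "right_ideal a = right_ideal (a ^ n)"
  shows "right_core_inverse a (a ^ (n - 1) * y)"
proof -
  define z where "z = a ^ (n - 1) * y"
  have z: "a * z * a = a" "(a * z)\<^sup>\<star> = a * z"
    unfolding z_def using inv13_inverse_of_power[of a n y] y n ideal
    by (auto simp: right_core_inverse_iff)
  \<comment> \<open>Here \<open>n \<ge> 2\<close> matters: one factor \<open>a\<close> remains in
    front after passing to \<open>a ^ (n - 1)\<close>, so \<open>z\<close> lies in the right ideal
    of \<open>a\<close>, which \<open>a * z\<close> fixes.\<close>
  have "z = a * (a ^ (n - 2) * y)"
    unfolding z_def using n
    by (simp add: Suc_diff_Suc numeral_2_eq_2 flip: mult.assoc power_Suc)
  then have "a * z * z = z"
    using z(1) by (metis mult.assoc)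
  with z show ?thesis
    unfolding right_core_inverse_iff z_def by blast
qed

lemma inv13_if_right_core_invertible:
  fixes a :: "'a::star_ring"
  assumes "right_core_invertible a"
  shows "a \<in> inv13"
  using assms unfolding right_core_invertible_iff right_core_inverse_iff inv13_def by blast

text \<open>A \<open>{1,3}\<close>-inverse \<open>z\<close> of \<open>a\<close> need not lie in the
  right ideal of \<open>a\<close>. Writing \<open>a = a * (a * t)\<close> and replacing
  \<open>z\<close> by \<open>a * t * z\<close> moves it there without changing the projection
  \<open>a * z\<close>.\<close>

lemma right_core_invertible_if_inv13:
  fixes a :: "'a::star_ring"
  assumes "a \<in> inv13" "n \<ge> 2" "right_ideal a = right_ideal (a ^ n)"
  shows "right_core_invertible a"
proof -
  obtain z where z: "a * z * a = a" "(a * z)\<^sup>\<star> = a * z"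
    using assms(1) by (auto simp: inv13_def)
  have "right_ideal a = right_ideal (a ^ 2)"
    using right_ideal_eq_power_mono[OF assms(3), of 2] assms(2) by simp
  then obtain t where t: "a = a * (a * t)"
    using right_ideal_eq_power_iff[of 2 a] by (auto simp: power2_eq_square mult.assoc)
  have p: "a * (a * t * z) = a * z"
    using t by (metis mult.assoc)
  have "a * z * (a * t * z) = a * t * z"
    using z(1) by (metis mult.assoc)
  then have "right_core_inverse a (a * t * z)"
    by (simp add: right_core_inverse_iff p z)
  then show ?thesis
    by (auto simp: right_core_invertible_iff)
qed

lemma right_core_invertible_power:
  fixes a :: "'a::star_ring"
  assumes "right_core_invertible a" "n \<ge> 1"
  shows "right_core_invertible (a ^ n)" and "right_ideal a = right_ideal (a ^ n)"
proof -
  obtain x where x: "right_core_inverse a x"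
    using assms(1) by (auto simp: right_core_invertible_iff)
  show "right_core_invertible (a ^ n)"
    using right_core_inverse_power(1)[OF x assms(2)] by (auto simp: right_core_invertible_iff)
  show "right_ideal a = right_ideal (a ^ n)"
    using right_core_inverse_power(2)[OF x assms(2)] right_ideal_eq_power_iff[OF assms(2)] by blast
qed

theorem theorem3p1:
  fixes a :: "'a::star_ring"
  shows
    "(right_core_invertible a \<longleftrightarrow>
        a \<in> inv13 \<and> right_ideal a = right_ideal (a ^ 2)) \<and>
     (right_core_invertible a \<longleftrightarrow>
        a \<in> inv13 \<and> (\<forall>n::nat. n \<ge> 2 \<longrightarrow> right_ideal a = right_ideal (a ^ n))) \<and>
     (right_core_invertible a \<longleftrightarrow>
        a \<in> inv13 \<and> (\<exists>n::nat. n \<ge> 2 \<and> right_ideal a = right_ideal (a ^ n))) \<and>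
     (right_core_invertible a \<longleftrightarrow>
        (\<forall>n::nat. n \<ge> 2 \<longrightarrow>
           right_core_invertible (a ^ n) \<and> right_ideal a = right_ideal (a ^ n))) \<and>
     (right_core_invertible a \<longleftrightarrow>
        (\<exists>n::nat. n \<ge> 2 \<and>
           right_core_invertible (a ^ n) \<and> right_ideal a = right_ideal (a ^ n))) \<and>
     (right_core_invertible a \<longleftrightarrow>
        (\<forall>(n::nat) (k::nat). n \<ge> 2 \<and> k > n \<longrightarrow>
           a ^ n \<in> inv13 \<and> right_ideal a = right_ideal (a ^ k))) \<and>
     (right_core_invertible a \<longleftrightarrow>
        (\<exists>(n::nat) (k::nat). n \<ge> 2 \<and> k > n \<and>
           a ^ n \<in> inv13 \<and> right_ideal a = right_ideal (a ^ k))) \<and>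
     (right_core_invertible a \<longrightarrow>
        (\<forall>n::nat. n \<ge> 2 \<longrightarrow>
           (\<forall>x. right_core_inverse a x \<longrightarrow> right_core_inverse (a ^ n) (x ^ n)) \<and>
           (\<forall>y. right_core_inverse (a ^ n) y \<longrightarrow> right_core_inverse a (a ^ (n - 1) * y))))"
proof -
  have powers: "a ^ n \<in> inv13" "right_core_invertible (a ^ n)" "right_ideal a = right_ideal (a ^ n)"
    if "right_core_invertible a" "n \<ge> 2" for n
    using right_core_invertible_power[of a n] inv13_if_right_core_invertible[of "a ^ n"] that
    by auto
  \<comment> \<open>Allowing \<open>k = n\<close> lets this one implication serve both (vi) and
    (viii).\<close>
  have from_power: "right_core_invertible a"
    if "a ^ n \<in> inv13" "n \<ge> 2" "k \<ge> n" "right_ideal a = right_ideal (a ^ k)" for n k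
  proof -
    have "right_ideal a = right_ideal (a ^ n)"
      using right_ideal_eq_power_mono[OF that(4)] that by simp
    then show ?thesis
      using inv13_of_power[of a n] right_core_invertible_if_inv13[of a n] that by simp
  qed
  \<comment> \<open>Concrete exponents: they instantiate the universal conditions (v) and (vii), and
    they witness the existential conditions (vi) and (viii).\<close>
  have two: "(2::nat) \<ge> 2 \<and> (3::nat) > 2"
    by simp
  have ii: "right_core_invertible a \<longleftrightarrow> a \<in> inv13 \<and> right_ideal a = right_ideal (a ^ 2)"
    using powers(3) inv13_if_right_core_invertible right_core_invertible_if_inv13
    by (metis order_refl)
  have iii: "right_core_invertible a \<longleftrightarrow>
      a \<in> inv13 \<and> (\<forall>n::nat. n \<ge> 2 \<longrightarrow> right_ideal a = right_ideal (a ^ n))"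
    using ii powers(3) by blast
  have iv: "right_core_invertible a \<longleftrightarrow>
      a \<in> inv13 \<and> (\<exists>n::nat. n \<ge> 2 \<and> right_ideal a = right_ideal (a ^ n))"
    using ii right_core_invertible_if_inv13 by blast
  have vi_imp: "right_core_invertible a"
    if "n \<ge> 2" "right_core_invertible (a ^ n)" "right_ideal a = right_ideal (a ^ n)" for n
    using from_power[of n n] inv13_if_right_core_invertible that by blast
  have v: "right_core_invertible a \<longleftrightarrow>
      (\<forall>n::nat. n \<ge> 2 \<longrightarrow> right_core_invertible (a ^ n) \<and> right_ideal a = right_ideal (a ^ n))"
    using vi_imp powers(2,3) two by blast
  have vi: "right_core_invertible a \<longleftrightarrow>
      (\<exists>n::nat. n \<ge> 2 \<and> right_core_invertible (a ^ n) \<and> right_ideal a = right_ideal (a ^ n))"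
    using vi_imp powers(2,3) two by blast
  have viii_imp: "right_core_invertible a"
    if "n \<ge> 2 \<and> k > n" "a ^ n \<in> inv13" "right_ideal a = right_ideal (a ^ k)" for n k
    using from_power[of n k] that by simp
  have vii_if: "a ^ n \<in> inv13 \<and> right_ideal a = right_ideal (a ^ k)"
    if "right_core_invertible a" "n \<ge> 2 \<and> k > n" for n k
    using powers(1)[of n] powers(3)[of k] that by simp
  have vii: "right_core_invertible a \<longleftrightarrow> (\<forall>(n::nat) (k::nat). n \<ge> 2 \<and> k > n \<longrightarrow>
      a ^ n \<in> inv13 \<and> right_ideal a = right_ideal (a ^ k))"
    using viii_imp[OF two] vii_if two by metis
  have viii: "right_core_invertible a \<longleftrightarrow> (\<exists>(n::nat) (k::nat). n \<ge> 2 \<and> k > n \<and>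
      a ^ n \<in> inv13 \<and> right_ideal a = right_ideal (a ^ k))"
    using viii_imp vii_if two by metis
  \<comment> \<open>Descending from \<open>a ^ n\<close> to \<open>a\<close> requires the ideal
    equation, which \<open>powers(3)\<close> derives from the right core invertibility of
    \<open>a\<close>.\<close>
  have inverses: "right_core_invertible a \<longrightarrow> (\<forall>n::nat. n \<ge> 2 \<longrightarrow>
      (\<forall>x. right_core_inverse a x \<longrightarrow> right_core_inverse (a ^ n) (x ^ n)) \<and>
      (\<forall>y. right_core_inverse (a ^ n) y \<longrightarrow> right_core_inverse a (a ^ (n - 1) * y)))"
    using right_core_inverse_power(1)[of a] right_core_inverse_of_power[of a] powers(3) by auto
  show ?thesis
    by (intro conjI) (fact ii iii iv v vi vii viii inverses)+
qed

end
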